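(* Suppose that there exist a vector $\mu^*=(\mu^*_1,\dots,\mu^*_T)\in\mathbb{R}^T$ and a vector $S^*=(S^*_0,\dots,S^*_T)\in\mathbb{R}^{T+1}$ such that (i) $S^*$ is feasible for problem $\mathbf{P}$; (ii) for each $t$ with $1\le t\le T$, $x_t(S^* )$ minimises $C_t(x)-\mu^*_t x$ over $x\in X$; (iii) for each $t$ with $1\le t\le T-1$, \[ \begin{cases}\rho\mu^*_{t+1}=\mu^*_t & \text{if } 0<S^*_t<E,\\ \rho\mu^*_{t+1}\le\mu^*_t & \text{if } S^*_t=0,\\ \rho\mu^*_{t+1}\ge\mu^*_t & \text{if } S^*_t=E.\end{cases} \] Then $S^*$ solves problem $\mathbf{P}$, i.e. $G(S^* )\le G(S)$ for every feasible $S$.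
   Context: Data: an integer $T\ge1$; a capacity $E>0$; rate constraints $P_i>0$ (input) and $P_o>0$ (output); a leakage parameter $\rho$ with $0<\rho\le1$; $X=\{x\in\mathbb{R}:-P_o\le x\le P_i\}$; convex cost functions $C_t:\mathbb{R}\to\mathbb{R}$ for $1\le t\le T$; fixed real numbers $S^*_0$ and $S^*_T$ (the prescribed initial and final store levels). For $S=(S_0,\dots,S_T)\in\mathbb{R}^{T+1}$ put $x_t(S)=S_t-\rho S_{t-1}$, $1\le t\le T$. Problem $\mathbf{P}$: choose $S$ so as to minimise \[G(S)=\sum_{t=1}^T C_t(x_t(S))\] subject to the capacity constraints $S_0=S^*_0$, $S_T=S^*_T$, $0\le S_t\le E$ for $1\le t\le T-1$, and the rate constraints $x_t(S)\in X$ for $1\le t\le T$. A vector $S$ is called feasible if it satisfies both the capacity and the rate constraints. It is assumed that the set of feasible vectors is nonempty. *)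

theory Defs
  imports Complex_Main "HOL-Analysis.Convex"
begin

text \<open>
  A level vector \<open>(S\<^sub>0, \<dots>, S\<^sub>T)\<close> is a function \<open>S :: nat \<Rightarrow> real\<close> of which only the values at
  \<open>0, \<dots>, T\<close> are ever consulted; likewise \<open>C\<close> and \<open>\<mu>\<close> are only consulted at \<open>1, \<dots>, T\<close>.
\<close>

definition rate_set :: "real \<Rightarrow> real \<Rightarrow> real set" where
  "rate_set P_in P_out = {x. - P_out \<le> x \<and> x \<le> P_in}"

text \<open>The flow is only used for \<open>t \<ge> 1\<close>, where the truncated subtraction \<open>t - 1\<close> is the true one.\<close>

definition flow :: "real \<Rightarrow> (nat \<Rightarrow> real) \<Rightarrow> nat \<Rightarrow> real" where
  "flow \<rho> S t = S t - \<rho> * S (t - 1)"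

definition total_cost :: "nat \<Rightarrow> real \<Rightarrow> (nat \<Rightarrow> real \<Rightarrow> real) \<Rightarrow> (nat \<Rightarrow> real) \<Rightarrow> real" where
  "total_cost T \<rho> C S = (\<Sum>t = 1..T. C t (flow \<rho> S t))"

definition capacity_constraints ::
  "nat \<Rightarrow> real \<Rightarrow> real \<Rightarrow> real \<Rightarrow> (nat \<Rightarrow> real) \<Rightarrow> bool" where
  "capacity_constraints T E s\<^sub>0 s\<^sub>T S \<longleftrightarrow>
     S 0 = s\<^sub>0 \<and> S T = s\<^sub>T \<and> (\<forall>t. 1 \<le> t \<and> t \<le> T - 1 \<longrightarrow> 0 \<le> S t \<and> S t \<le> E)"

definition rate_constraints ::
  "nat \<Rightarrow> real \<Rightarrow> real \<Rightarrow> real \<Rightarrow> (nat \<Rightarrow> real) \<Rightarrow> bool" where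
  "rate_constraints T P_in P_out \<rho> S \<longleftrightarrow>
     (\<forall>t. 1 \<le> t \<and> t \<le> T \<longrightarrow> flow \<rho> S t \<in> rate_set P_in P_out)"

definition feasible ::
  "nat \<Rightarrow> real \<Rightarrow> real \<Rightarrow> real \<Rightarrow> real \<Rightarrow> real \<Rightarrow> real \<Rightarrow> (nat \<Rightarrow> real) \<Rightarrow> bool" where
  "feasible T E P_in P_out \<rho> s\<^sub>0 s\<^sub>T S \<longleftrightarrow>
     capacity_constraints T E s\<^sub>0 s\<^sub>T S \<and> rate_constraints T P_in P_out \<rho> S"

definition solves_problem ::
  "nat \<Rightarrow> real \<Rightarrow> real \<Rightarrow> real \<Rightarrow> real \<Rightarrow> real \<Rightarrow> real \<Rightarrow> (nat \<Rightarrow> real \<Rightarrow> real)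
    \<Rightarrow> (nat \<Rightarrow> real) \<Rightarrow> bool" where
  "solves_problem T E P_in P_out \<rho> s\<^sub>0 s\<^sub>T C S \<longleftrightarrow>
     feasible T E P_in P_out \<rho> s\<^sub>0 s\<^sub>T S \<and>
     (\<forall>S'. feasible T E P_in P_out \<rho> s\<^sub>0 s\<^sub>T S' \<longrightarrow> total_cost T \<rho> C S \<le> total_cost T \<rho> C S')"

end

theory Submission
  imports Defs
begin

text \<open>
  The vector \<open>\<mu>\<close> is a family of Lagrange multipliers for the relations
  \<open>x\<^sub>t = S\<^sub>t - \<rho> S\<^sub>t\<^sub>-\<^sub>1\<close>, and the theorem is the sufficiency half of Lagrangian duality.
  Let \<open>S'\<close> be another feasible vector and \<open>D = S' - S\<close>.  Since each flow of \<open>S\<close>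
  minimises \<open>C\<^sub>t(x) - \<mu>\<^sub>t x\<close>, replacing \<open>S\<close> by \<open>S'\<close> raises the cost at time \<open>t\<close> by at least
  \<open>\<mu>\<^sub>t (D\<^sub>t - \<rho> D\<^sub>t\<^sub>-\<^sub>1)\<close>.  It remains to see that these lower bounds have a nonnegative sum.

  Summation by parts (\<open>sum_flow_by_parts\<close>) turns that sum into the sum of
  \<open>(\<mu>\<^sub>t - \<rho> \<mu>\<^sub>t\<^sub>+\<^sub>1) D\<^sub>t\<close> over the interior times, because \<open>D\<close> vanishes at both ends.
  Complementary slackness makes every term nonnegative (\<open>slackness_term_nonneg\<close>): the coefficient
  is zero when the store is strictly between empty and full, and at either end of the
  range it never has the sign opposite to the only direction in which the level is free to move.
\<close>

lemma flow_diff: "flow \<rho> S' t - flow \<rho> S t = flow \<rho> (\<lambda>i. S' i - S i) t"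
  by (simp add: flow_def algebra_simps)

text \<open>
  An empty time range would have no last multiplier for the boundary term, hence the upper bound
  \<open>Suc n\<close>; the other boundary term is absent because \<open>D\<close> starts at zero.
\<close>

lemma sum_flow_by_parts:
  assumes "D 0 = 0"
  shows "(\<Sum>t = 1..Suc n. \<mu> t * flow \<rho> D t)
       = (\<Sum>t = 1..n. (\<mu> t - \<rho> * \<mu> (t + 1)) * D t) + \<mu> (Suc n) * D (Suc n)"
proof (induction n)
  case 0
  then show ?case using assms by (simp add: flow_def)
next
  case (Suc n)
  have "(\<Sum>t = 1..Suc (Suc n). \<mu> t * flow \<rho> D t)
      = (\<Sum>t = 1..Suc n. \<mu> t * flow \<rho> D t) + \<mu> (Suc (Suc n)) * flow \<rho> D (Suc (Suc n))"
    by simp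
  then show ?case
    unfolding Suc.IH by (simp add: flow_def algebra_simps)
qed

text \<open>
  Raising the level by one unit at time \<open>t\<close> raises the flow at \<open>t\<close> by one, priced at
  \<open>m = \<mu>\<^sub>t\<close>, and lowers the next flow by \<open>\<rho>\<close>, which saves \<open>r = \<rho> \<mu>\<^sub>t\<^sub>+\<^sub>1\<close>.  So \<open>m - r\<close> is the net
  price of a higher level, and a nonzero price is allowed only at the end of \<open>[0, E]\<close> that blocks
  the profitable direction.
\<close>

lemma slackness_term_nonneg:
  fixes E m r s s' :: real
  assumes "0 \<le> s" "s \<le> E" "0 \<le> s'" "s' \<le> E"
    and "0 < s \<and> s < E \<longrightarrow> r = m"
    and "s = 0 \<longrightarrow> r \<le> m"
    and "s = E \<longrightarrow> r \<ge> m"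
  shows "0 \<le> (m - r) * (s' - s)"
proof -
  consider "0 < s \<and> s < E" | "s = 0" | "s = E"
    using assms(1,2) by linarith
  then show ?thesis
    using assms(3-) by cases (auto intro: mult_nonneg_nonneg mult_nonpos_nonpos)
qed

theorem theorem1:
  fixes T :: nat
    and E P_in P_out \<rho> s\<^sub>0 s\<^sub>T :: real
    and C :: "nat \<Rightarrow> real \<Rightarrow> real"
    and \<mu> S :: "nat \<Rightarrow> real"
  assumes "T \<ge> 1"
    and "E > 0" and "P_in > 0" and "P_out > 0"
    and "0 < \<rho>" and "\<rho> \<le> 1"
    and "\<And>t. 1 \<le> t \<Longrightarrow> t \<le> T \<Longrightarrow> convex_on UNIV (C t)"
    and "\<exists>S'. feasible T E P_in P_out \<rho> s\<^sub>0 s\<^sub>T S'"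
    and "feasible T E P_in P_out \<rho> s\<^sub>0 s\<^sub>T S"
    and "\<And>t. 1 \<le> t \<Longrightarrow> t \<le> T \<Longrightarrow>
           is_arg_min (\<lambda>x. C t x - \<mu> t * x) (\<lambda>x. x \<in> rate_set P_in P_out) (flow \<rho> S t)"
    and "\<And>t. 1 \<le> t \<Longrightarrow> t \<le> T - 1 \<Longrightarrow>
           (0 < S t \<and> S t < E \<longrightarrow> \<rho> * \<mu> (t + 1) = \<mu> t) \<and>
           (S t = 0 \<longrightarrow> \<rho> * \<mu> (t + 1) \<le> \<mu> t) \<and>
           (S t = E \<longrightarrow> \<rho> * \<mu> (t + 1) \<ge> \<mu> t)"
  shows "solves_problem T E P_in P_out \<rho> s\<^sub>0 s\<^sub>T C S"
proof -
  have "total_cost T \<rho> C S \<le> total_cost T \<rho> C S'"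
    if feas': "feasible T E P_in P_out \<rho> s\<^sub>0 s\<^sub>T S'" for S'
  proof -
    define D where "D = (\<lambda>t. S' t - S t)"
    obtain n where n: "T = Suc n"
      using \<open>T \<ge> 1\<close> by (cases T) auto
    have cap: "capacity_constraints T E s\<^sub>0 s\<^sub>T S" "capacity_constraints T E s\<^sub>0 s\<^sub>T S'"
      using assms(9) feas' by (simp_all add: feasible_def)
    then have D_ends: "D 0 = 0" "D T = 0"
      by (simp_all add: D_def capacity_constraints_def)
    have interior: "0 \<le> (\<mu> t - \<rho> * \<mu> (t + 1)) * D t" if "t \<in> {1..n}" for t
    proof -
      have t: "1 \<le> t" "t \<le> T - 1" using that n by auto
      have "0 \<le> S t" "S t \<le> E" "0 \<le> S' t" "S' t \<le> E"
        using cap t by (auto simp: capacity_constraints_def)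
      then show ?thesis
        unfolding D_def using assms(11)[OF t] by (intro slackness_term_nonneg) auto
    qed
    have step: "\<mu> t * flow \<rho> D t \<le> C t (flow \<rho> S' t) - C t (flow \<rho> S t)"
      if "t \<in> {1..T}" for t
    proof -
      have t: "1 \<le> t" "t \<le> T" using that by auto
      have "flow \<rho> S' t \<in> rate_set P_in P_out"
        using feas' t by (simp add: feasible_def rate_constraints_def)
      then have "C t (flow \<rho> S t) - \<mu> t * flow \<rho> S t \<le> C t (flow \<rho> S' t) - \<mu> t * flow \<rho> S' t"
        using assms(10)[OF t] by (simp add: is_arg_min_linorder)
      then show ?thesis
        unfolding D_def flow_diff[symmetric] by (simp add: algebra_simps)
    qed
    have "0 \<le> (\<Sum>t = 1..n. (\<mu> t - \<rho> * \<mu> (t + 1)) * D t)"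
      by (intro sum_nonneg interior)
    also have "\<dots> = (\<Sum>t = 1..T. \<mu> t * flow \<rho> D t)"
      using sum_flow_by_parts[of D \<mu> \<rho> n] D_ends n by simp
    also have "\<dots> \<le> (\<Sum>t = 1..T. C t (flow \<rho> S' t) - C t (flow \<rho> S t))"
      by (intro sum_mono step)
    also have "\<dots> = total_cost T \<rho> C S' - total_cost T \<rho> C S"
      by (simp add: total_cost_def sum_subtractf)
    finally show ?thesis by simp
  qed
  then show ?thesis
    using assms(9) by (simp add: solves_problem_def)
qed

end
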